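(* Every connected, nonhamiltonian, locally linear graph with $n \ge 3$ vertices has at least $2n$ edges, and for every integer $n \ge 12$ there exists a connected, nonhamiltonian, locally linear graph with $n$ vertices and exactly $2n$ edges. That is, the minimum size of a nonhamiltonian locally linear graph of order $n$ is $2n$.
   Context: All graphs are finite, simple and connected. For a vertex $v$ of a graph $G$, $N(v)$ is the set of neighbours of $v$ and $G[S]$ is the subgraph induced by a vertex set $S$. A graph $G$ is locally linear if for every vertex $v$ of $G$ the induced subgraph $G[N(v)]$ is a path. A graph is hamiltonian if it contains a cycle through all of its vertices. The size of a graph is its number of edges. *)

theory Defs
  imports "Graph_Theory.Graph_Theory"
begin

text \<open>Finite simple graphs are the symmetric digraphs of the locale \<^locale>\<open>graph\<close>; an undirected
  edge is a pair of opposite arcs, so edges are counted as sets of end vertices.\<close>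

definition edges :: "('a, 'b) pre_digraph \<Rightarrow> 'a set set" where
  "edges G = (\<lambda>e. {tail G e, head G e}) ` arcs G"

definition neighbours :: "('a, 'b) pre_digraph \<Rightarrow> 'a \<Rightarrow> 'a set" where
  "neighbours G v = {u. v \<rightarrow>\<^bsub>G\<^esub> u}"

text \<open>The one-vertex path is allowed, the empty graph is not a path.\<close>

definition path_graph :: "('a, 'b) pre_digraph \<Rightarrow> bool" where
  "path_graph H \<longleftrightarrow> graph H \<and> (\<exists>xs. xs \<noteq> [] \<and> distinct xs \<and> verts H = set xs \<and>
     arcs_ends H = {(xs ! i, xs ! j) | i j. i < length xs \<and> j < length xs \<and> (j = Suc i \<or> i = Suc j)})"

definition locally_linear :: "('a, 'b) pre_digraph \<Rightarrow> bool" where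
  "locally_linear G \<longleftrightarrow> (\<forall>v \<in> verts G. path_graph (G \<restriction> neighbours G v))"

text \<open>The bound on the length excludes the closed walk \<open>a, b, a\<close>, which the library's notion of
  cycle admits in symmetric digraphs.\<close>

definition hamiltonian :: "('a, 'b) pre_digraph \<Rightarrow> bool" where
  "hamiltonian G \<longleftrightarrow> (\<exists>p. pre_digraph.cycle G p \<and> 3 \<le> length p \<and> tail G ` set p = verts G)"

definition nonham_locally_linear :: "('a, 'b) pre_digraph \<Rightarrow> bool" where
  "nonham_locally_linear G \<longleftrightarrow>
     graph G \<and> Digraph_Component.connected G \<and> locally_linear G \<and> \<not> hamiltonian G"

end

theory Submission
  imports Defs
begin

unbundle no funcset_syntax

text \<open>Since the neighbourhood of a vertex of degree \<open>d\<close> is a path, the vertex lies in \<open>d - 1\<close> triangles,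
  so a graph with \<open>n\<close> vertices, \<open>m\<close> edges and \<open>t\<close> triangles satisfies \<open>2m = 3t + n\<close>. Every edge lies
  in at most two triangles, and the triangles can be listed so that each one shares an edge with an
  earlier one; hence \<open>n \<le> t + 2\<close>. If \<open>m < 2n\<close>, then \<open>t < n\<close>, and \<open>t = n - 2\<close> by parity. Then each
  triangle of the list adds a new vertex, so that the triangles form a disc whose boundary is a
  Hamiltonian cycle. Conversely, annuli with \<open>t = n\<close> attain the bound: four ears with only four
  neighbours altogether rule out a Hamiltonian cycle.\<close>

section \<open>Closed vertex walks and Hamiltonian cycles\<close>

definition walk_edges :: "'a list \<Rightarrow> 'a set set" where
  "walk_edges w = (\<lambda>(x, y). {x, y}) ` set (vwalk_arcs w)"

lemma vwalk_arcs_split: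
  assumes "(a, b) \<in> set (vwalk_arcs w)"
  obtains P Q where "w = P @ a # b # Q"
proof -
  have "\<exists>P Q. w = P @ a # b # Q" using assms
  proof (induction w rule: vwalk_arcs.induct)
    case (3 x y xs)
    show ?case
    proof (cases "(a, b) = (x, y)")
      case True
      then show ?thesis by (intro exI[of _ "[]"] exI[of _ xs]) auto
    next
      case False
      then obtain P Q where "y # xs = P @ a # b # Q" using 3 by auto
      then show ?thesis by (intro exI[of _ "x # P"] exI[of _ Q]) auto
    qed
  qed auto
  then show ?thesis using that by blast
qed

lemma vwalk_arcs_append_Cons:
  "vwalk_arcs (P @ a # b # Q) = vwalk_arcs (P @ [a]) @ (a, b) # vwalk_arcs (b # Q)"
  using vwalk_arcs_append[of "P @ [a]" "b # Q"] by simp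

text \<open>Closed paths are kept as vertex lists, where inserting a vertex is a list operation. The
  first vertex is repeated at the end, so only the tail has to be distinct. Degenerate walks
  \<open>[v]\<close> and \<open>[a, b, a]\<close> qualify as well; three vertices exclude them
  later.\<close>

definition closed_vpath :: "('a, 'b) pre_digraph \<Rightarrow> 'a list \<Rightarrow> bool" where
  "closed_vpath G w \<longleftrightarrow> vwalk w G \<and> hd w = last w \<and> distinct (tl w)"

text \<open>The arc from \<open>a\<close> to \<open>b\<close> is replaced by the detour over
  \<open>c\<close>. An inclusion suffices for the edges, since a disc only requires its boundary
  edges to occur in the walk.\<close>

lemma closed_vpath_detour_arc:
  assumes w: "closed_vpath G w" and ab: "(a, b) \<in> set (vwalk_arcs w)" and c: "c \<notin> set w"
    and adj: "a \<rightarrow>\<^bsub>G\<^esub> c" "c \<rightarrow>\<^bsub>G\<^esub> b" and cV: "c \<in> verts G"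
  shows "\<exists>w'. closed_vpath G w' \<and> set w' = insert c (set w) \<and>
           insert {a, c} (insert {b, c} (walk_edges w - {{a, b}})) \<subseteq> walk_edges w'"
proof -
  obtain P Q where eq: "w = P @ a # b # Q" using vwalk_arcs_split[OF ab] .
  define w' where "w' = P @ a # c # b # Q"
  have arcs: "vwalk_arcs w = vwalk_arcs (P @ [a]) @ (a, b) # vwalk_arcs (b # Q)"
    "vwalk_arcs w' = vwalk_arcs (P @ [a]) @ (a, c) # (c, b) # vwalk_arcs (b # Q)"
    unfolding eq w'_def by (simp_all only: vwalk_arcs_append_Cons) simp
  have "vwalk w' G"
    using w adj cV arcs unfolding closed_vpath_def vwalk_def by (auto simp: eq w'_def)
  moreover have "hd w' = last w'"
    using w unfolding closed_vpath_def eq w'_def by (cases P) auto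
  moreover have "distinct (tl w')"
    using w c unfolding closed_vpath_def eq w'_def by (cases P) auto
  ultimately have "closed_vpath G w'" by (simp add: closed_vpath_def)
  moreover have "set w' = insert c (set w)" by (auto simp: eq w'_def)
  moreover have "insert {a, c} (insert {b, c} (walk_edges w - {{a, b}})) \<subseteq> walk_edges w'"
    unfolding walk_edges_def arcs by auto
  ultimately show ?thesis by blast
qed

text \<open>This passes from vertex lists to the arc lists in which \<open>hamiltonian\<close> is
  phrased, by choosing an arc for each consecutive pair.\<close>

lemma vwalk_imp_awalk_verts:
  assumes "wf_digraph G" "vwalk w G"
  shows "\<exists>p. pre_digraph.awalk G (hd w) p (last w) \<and> pre_digraph.awalk_verts G (hd w) p = w"
proof -
  interpret wf_digraph G by fact
  show ?thesis using assms(2)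
  proof (induction rule: vwalk_induct)
    case (Base u)
    then show ?case by (intro exI[of _ "[]"]) (auto simp: awalk_Nil_iff)
  next
    case (Cons u v es)
    then obtain p where p: "awalk v p (last (v # es))" "awalk_verts v p = v # es" by auto
    from Cons(1) obtain e where "e \<in> arcs G" "tail G e = u" "head G e = v" by auto
    with p show ?case by (intro exI[of _ "e # p"]) (auto simp: awalk_Cons_iff)
  qed
qed

lemma closed_vpath_imp_hamiltonian:
  assumes "wf_digraph G" "closed_vpath G w" "set w = verts G" "3 \<le> card (verts G)"
  shows "hamiltonian G"
proof -
  interpret wf_digraph G by fact
  from assms(2) have w: "vwalk w G" "hd w = last w" "distinct (tl w)"
    by (auto simp: closed_vpath_def)
  obtain p where p: "awalk (hd w) p (last w)" "awalk_verts (hd w) p = w"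
    using vwalk_imp_awalk_verts[OF assms(1) w(1)] by auto
  have len: "3 \<le> length w" using assms(3,4) card_length[of w] by simp
  have sp: "length w = Suc (length p)" using p(2) length_awalk_verts by metis
  have pne: "p \<noteq> []" using len sp by auto
  have wc: "w = map (tail G) p @ [head G (last p)]"
    using p(2) pne by (simp add: awalk_verts_conv)
  have "last w \<in> set (map (tail G) p)" using w(2) wc pne by (cases p) auto
  then have tails: "tail G ` set p = verts G" using wc assms(3) by auto
  have "card (verts G) \<le> length p"
    using card_length[of "map (tail G) p"] tails by simp
  moreover have "cycle p" unfolding cycle_def using p w(2,3) pne by metis
  ultimately show ?thesis unfolding hamiltonian_def using assms(4) tails by (intro exI[of _ p]) auto
qed

text \<open>In a Hamiltonian cycle every vertex of \<open>Q\<close> is preceded and followed by a vertex of \<open>C\<close>. Since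
  \<open>C\<close> is not larger than \<open>Q\<close>, the cycle never leaves \<open>Q \<union> C\<close>.\<close>

lemma not_hamiltonian_if_few_neighbours:
  assumes G: "graph G" and fin: "finite C" and card: "card C \<le> card Q" and Q: "Q \<subseteq> verts G" "Q \<noteq> {}"
    and nb: "\<And>q u. q \<in> Q \<Longrightarrow> q \<rightarrow>\<^bsub>G\<^esub> u \<Longrightarrow> u \<in> C" and v: "v \<in> verts G" "v \<notin> Q \<union> C"
  shows "\<not> hamiltonian G"
proof
  interpret graph G by fact
  assume "hamiltonian G"
  then obtain p u where p: "awalk u p u" "distinct (tl (awalk_verts u p))" "p \<noteq> []"
    and tails: "tail G ` set p = verts G"
    unfolding hamiltonian_def cycle_def by auto
  have pa: "set p \<subseteq> arcs G" using p(1) by (auto simp: awalk_def)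
  have cas: "cas u p u" using p(1) by (simp add: awalk_def)
  then have "tail G (hd p) = u" using p(3) by (cases p) auto
  then have hds: "awalk_verts u p = u # map (head G) p"
    using awalk_verts_conv'[OF cas] p(3) by simp
  have dh: "distinct (map (head G) p)" using p(2) hds by simp
  have tls: "awalk_verts u p = map (tail G) p @ [u]"
    using p(3) awlast_of_awalk[OF p(1)] by (simp add: awalk_verts_conv)
  \<comment> \<open>The vertex list of the closed walk is \<open>u\<close> followed by the heads,
    and also the tails followed by \<open>u\<close>. Cancelling \<open>u\<close> shows that the
    tails are a permutation of the heads.\<close>
  have "mset (map (tail G) p) = mset (map (head G) p)"
    using arg_cong[OF tls, of mset] arg_cong[OF hds, of mset] by simp
  then have dt: "distinct (map (tail G) p)" and "set (map (tail G) p) = set (map (head G) p)"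
    using dh mset_eq_imp_distinct_iff mset_eq_setD by blast+
  then have heads: "head G ` set p = verts G" using tails by simp
  have injt: "inj_on (tail G) (set p)" and injh: "inj_on (head G) (set p)"
    using dt dh by (auto simp: distinct_map)
  have dom: "tail G e \<rightarrow>\<^bsub>G\<^esub> head G e" "head G e \<rightarrow>\<^bsub>G\<^esub> tail G e" if "e \<in> set p" for e
  proof -
    show "tail G e \<rightarrow>\<^bsub>G\<^esub> head G e" using that pa by (auto simp: arcs_ends_conv)
    then show "head G e \<rightarrow>\<^bsub>G\<^esub> tail G e" using arcs_ends_symmetric[OF sym_arcs] by blast
  qed
  \<comment> \<open>The arcs entering \<open>Q\<close>: every vertex of \<open>Q\<close> is the head
    of exactly one of them, and their tails are distinct elements of \<open>C\<close>. As
    \<open>C\<close> is not larger than \<open>Q\<close>, these tails exhaust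
    \<open>C\<close>.\<close>
  define B where "B = {e \<in> set p. head G e \<in> Q}"
  have Bp: "B \<subseteq> set p" by (auto simp: B_def)
  have hB: "head G ` B = Q"
  proof
    show "Q \<subseteq> head G ` B"
    proof
      fix q assume q: "q \<in> Q"
      then have "q \<in> head G ` set p" using heads Q(1) by auto
      then show "q \<in> head G ` B" using q by (auto simp: B_def)
    qed
  qed (auto simp: B_def)
  have "card B = card Q" using card_image[OF inj_on_subset[OF injh Bp]] hB by simp
  moreover have "card (tail G ` B) = card B" by (rule card_image[OF inj_on_subset[OF injt Bp]])
  moreover have sub: "tail G ` B \<subseteq> C"
  proof
    fix x assume "x \<in> tail G ` B"
    then obtain e where "e \<in> set p" "head G e \<in> Q" "x = tail G e" by (auto simp: B_def)
    then show "x \<in> C" using nb dom(2) by simp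
  qed
  ultimately have tB: "tail G ` B = C" using fin card by (intro card_seteq) auto
  \<comment> \<open>An arc of the cycle that leaves \<open>C\<close> shares its tail with an arc of
    \<open>B\<close>, hence is that arc and enters \<open>Q\<close>.\<close>
  have step: "head G e \<in> Q \<union> C" if e: "e \<in> set p" and t: "tail G e \<in> Q \<union> C" for e
  proof (cases "tail G e \<in> Q")
    case True
    then show ?thesis using nb dom[OF e] by blast
  next
    case False
    then obtain e' where "e' \<in> B" "tail G e = tail G e'" using t tB by blast
    moreover then have "e = e'" using injt e by (auto simp: B_def inj_on_def)
    ultimately show ?thesis by (auto simp: B_def)
  qed
  have fwd: "set (awalk_verts x r) \<subseteq> S"
    if "awalk x r y" "x \<in> S" "\<And>e. e \<in> set r \<Longrightarrow> tail G e \<in> S \<Longrightarrow> head G e \<in> S" for x r y S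
    using that by (induction r arbitrary: x) (auto simp: awalk_Cons_iff)
  have bwd: "y \<in> S"
    if "awalk x r y" "z \<in> S" "z \<in> set (awalk_verts x r)"
      "\<And>e. e \<in> set r \<Longrightarrow> tail G e \<in> S \<Longrightarrow> head G e \<in> S" for x r y z S
    using that
  proof (induction r arbitrary: x z)
    case Nil
    then show ?case by (auto simp: awalk_Nil_iff)
  next
    case (Cons e r)
    from Cons.prems(1) have a: "awalk (head G e) r y" "tail G e = x" "x \<in> verts G"
      by (auto simp: awalk_Cons_iff)
    show ?case
    proof (cases "z \<in> set (awalk_verts (head G e) r)")
      case True
      then show ?thesis using Cons.IH[OF a(1) Cons.prems(2)] Cons.prems(4) by auto
    next
      case False
      then have "head G e \<in> S" using Cons.prems by auto
      then show ?thesis using Cons.IH[OF a(1)] Cons.prems(4) hd_in_awalk_verts(1)[OF a(1)] by auto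
    qed
  qed
  have vs: "set (awalk_verts u p) = verts G"
    using tails awalk_hd_in_verts[OF p(1)] unfolding tls by auto
  from Q obtain q where "q \<in> Q" "q \<in> verts G" by blast
  \<comment> \<open>The walk meets \<open>Q\<close> somewhere, so its end \<open>u\<close> lies in
    \<open>Q \<union> C\<close>. As \<open>u\<close> is also its start, the whole walk stays
    there.\<close>
  then have "u \<in> Q \<union> C" using bwd[OF p(1), of q "Q \<union> C"] vs step by auto
  then have "set (awalk_verts u p) \<subseteq> Q \<union> C" using fwd[OF p(1)] step by blast
  then show False using vs v by auto
qed

section \<open>Triangles of a locally linear graph\<close>

lemma dominates_induce_subgraph_iff:
  "u \<rightarrow>\<^bsub>G \<restriction> S\<^esub> v \<longleftrightarrow> u \<rightarrow>\<^bsub>G\<^esub> v \<and> u \<in> S \<and> v \<in> S"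
  by (auto simp: arcs_ends_conv image_iff)

text \<open>The cardinality bound excludes the complete graph on two vertices, whose neighbourhoods
  are one-vertex paths and whose edge lies in no triangle.\<close>

locale locally_linear_graph = graph +
  assumes linear: "locally_linear G" and conn: "Digraph_Component.connected G"
    and card_verts: "3 \<le> card (verts G)"
begin

definition triangles :: "'a set set" where
  "triangles = {{a, b, c} | a b c. a \<rightarrow> b \<and> b \<rightarrow> c \<and> a \<rightarrow> c}"

lemma adj_sym: "u \<rightarrow> v \<Longrightarrow> v \<rightarrow> u"
  using arcs_ends_symmetric[OF sym_arcs] .

lemma adj_irrefl: "\<not> u \<rightarrow> u"
  using adj_not_same by blast

lemma trianglesI: "a \<rightarrow> b \<Longrightarrow> b \<rightarrow> c \<Longrightarrow> a \<rightarrow> c \<Longrightarrow> {a, b, c} \<in> triangles"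
  unfolding triangles_def by blast

lemma adj_of_triangle:
  assumes "T \<in> triangles" "x \<in> T" "y \<in> T" "x \<noteq> y"
  shows "x \<rightarrow> y"
proof -
  obtain a b c where T: "T = {a, b, c}" "a \<rightarrow> b" "b \<rightarrow> c" "a \<rightarrow> c"
    using assms(1) unfolding triangles_def by blast
  then show ?thesis using adj_sym[OF T(2)] adj_sym[OF T(3)] adj_sym[OF T(4)] assms(2-4) by auto
qed

lemma card_triangle: "T \<in> triangles \<Longrightarrow> card T = 3"
  unfolding triangles_def by (auto simp: card_insert_if adj_irrefl)

lemma triangle_subset_verts: "T \<in> triangles \<Longrightarrow> T \<subseteq> verts G"
  unfolding triangles_def using adj_in_verts by blast

lemma finite_triangles: "finite triangles"
proof (rule finite_subset)
  show "triangles \<subseteq> Pow (verts G)" using triangle_subset_verts by blast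
qed simp

lemma triangle_completion:
  assumes "T \<in> triangles" "a \<in> T" "b \<in> T" "a \<noteq> b"
  obtains c where "T = {a, b, c}" "a \<rightarrow> b" "b \<rightarrow> c" "a \<rightarrow> c" "c \<noteq> a" "c \<noteq> b"
proof -
  have "card (T - {a, b}) = 1"
    using assms card_triangle[OF assms(1)] by (subst card_Diff_subset) auto
  then obtain c where c: "T - {a, b} = {c}" by (metis card_1_singletonE)
  then have "c \<in> T" "c \<noteq> a" "c \<noteq> b" "T = {a, b, c}" using assms(2,3) by blast+
  then show ?thesis
    using that adj_of_triangle[OF assms] adj_of_triangle[OF assms(1,3)] adj_of_triangle[OF assms(1,2)]
    by metis
qed

lemma adj_closed_eq_verts:
  assumes "v \<in> W" "v \<in> verts G" "\<And>x y. x \<in> W \<Longrightarrow> x \<rightarrow> y \<Longrightarrow> y \<in> W"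
  shows "verts G \<subseteq> W"
proof
  fix u assume "u \<in> verts G"
  then have "v \<rightarrow>\<^sup>* u"
    using symmetric_connected_imp_strongly_connected[OF sym_arcs conn] assms(2)
    unfolding strongly_connected_def by blast
  then show "u \<in> W"
  proof (induction rule: reachable_induct)
    case base
    show ?case by (rule assms(1))
  next
    case (step x y)
    then show ?case using assms(3) by blast
  qed
qed

definition link_path :: "'a \<Rightarrow> 'a list \<Rightarrow> bool" where
  "link_path v xs \<longleftrightarrow> distinct xs \<and> set xs = neighbours G v \<and> 2 \<le> length xs \<and>
     (\<forall>i j. i < length xs \<longrightarrow> j < length xs \<longrightarrow> (xs ! i \<rightarrow> xs ! j) = (j = Suc i \<or> i = Suc j))"

text \<open>The point is the length bound. If \<open>u\<close> were the only neighbour of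
  \<open>v\<close>, then a neighbour of \<open>v\<close> on the path of \<open>u\<close> could only
  be \<open>u\<close> itself, which is absurd. So \<open>v\<close> would be isolated on that path
  and hence all of it, and by connectedness the graph would consist of \<open>u\<close> and
  \<open>v\<close>.\<close>

lemma link_path_exists:
  assumes v: "v \<in> verts G"
  obtains xs where "link_path v xs"
proof -
  have pre: "\<exists>xs. xs \<noteq> [] \<and> distinct xs \<and> set xs = neighbours G v \<and>
     (\<forall>i j. i < length xs \<longrightarrow> j < length xs \<longrightarrow> (xs ! i \<rightarrow> xs ! j) = (j = Suc i \<or> i = Suc j))"
    if "v \<in> verts G" for v
  proof -
    have "path_graph (G \<restriction> neighbours G v)" using linear that by (simp add: locally_linear_def)
    then obtain xs where xs: "xs \<noteq> []" "distinct xs" "neighbours G v = set xs"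
      "arcs_ends (G \<restriction> neighbours G v) =
        {(xs ! i, xs ! j) | i j. i < length xs \<and> j < length xs \<and> (j = Suc i \<or> i = Suc j)}"
      unfolding path_graph_def induce_subgraph_verts by blast
    have "(xs ! i \<rightarrow> xs ! j) = (j = Suc i \<or> i = Suc j)" if "i < length xs" "j < length xs" for i j
    proof -
      have "(xs ! i \<rightarrow> xs ! j) = ((xs ! i, xs ! j) \<in> arcs_ends (G \<restriction> neighbours G v))"
        using that by (simp add: dominates_induce_subgraph_iff xs(3))
      also have "\<dots> = (j = Suc i \<or> i = Suc j)"
        unfolding xs(4) using that xs(2) by (auto simp: nth_eq_iff_index_eq)
      finally show ?thesis .
    qed
    then show ?thesis using xs(1-3) by (intro exI[of _ xs]) simp
  qed
  obtain xs where xs: "xs \<noteq> []" "distinct xs" "set xs = neighbours G v"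
    "\<forall>i j. i < length xs \<longrightarrow> j < length xs \<longrightarrow> (xs ! i \<rightarrow> xs ! j) = (j = Suc i \<or> i = Suc j)"
    using pre[OF v] by blast
  have "2 \<le> length xs"
  proof (rule ccontr)
    assume "\<not> 2 \<le> length xs"
    then have "length xs = 1" using xs(1) length_greater_0_conv[of xs] by linarith
    then obtain u where "xs = [u]" by (auto simp: length_Suc_conv)
    then have u: "neighbours G v = {u}" using xs(3) by simp
    then have vu: "v \<rightarrow> u" by (auto simp: neighbours_def)
    obtain ys where ys: "distinct ys" "set ys = neighbours G u"
      "\<forall>i j. i < length ys \<longrightarrow> j < length ys \<longrightarrow> (ys ! i \<rightarrow> ys ! j) = (j = Suc i \<or> i = Suc j)"
      using pre[of u] adj_in_verts[OF vu] by blast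
    have "v \<in> set ys" using adj_sym[OF vu] ys(2) by (simp add: neighbours_def)
    then obtain i where i: "i < length ys" "ys ! i = v" by (auto simp: in_set_conv_nth)
    have "length ys \<le> 1"
    proof (rule ccontr)
      assume "\<not> length ys \<le> 1"
      then obtain j where j: "j < length ys" "j = Suc i \<or> i = Suc j"
        using i(1) by (metis Suc_lessD Suc_lessI not0_implies_Suc not_le One_nat_def)
      then have "v \<rightarrow> ys ! j" using ys(3) i by auto
      then have "ys ! j = u" using u by (auto simp: neighbours_def)
      then have "u \<in> neighbours G u" using ys(2) j(1) nth_mem by metis
      then show False using adj_irrefl by (simp add: neighbours_def)
    qed
    then have "length ys = 1" using i by linarith
    then have "neighbours G u = {v}" using ys(2) i by (auto simp: length_Suc_conv)
    then have "verts G \<subseteq> {u, v}"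
      using u v by (intro adj_closed_eq_verts[of v]) (auto simp: neighbours_def)
    then have "card (verts G) \<le> card {u, v}" by (intro card_mono) auto
    also have "\<dots> \<le> 2" by (simp add: card_insert_if)
    finally show False using card_verts by simp
  qed
  then show ?thesis using that xs unfolding link_path_def by blast
qed

lemma link_path_adj:
  assumes "link_path v xs" "i < length xs" "j < length xs"
  shows "(xs ! i \<rightarrow> xs ! j) = (j = Suc i \<or> i = Suc j)"
  using assms unfolding link_path_def by blast

lemma link_path_index:
  assumes "link_path v xs" "v \<rightarrow> u"
  obtains i where "i < length xs" "u = xs ! i"
  using assms unfolding link_path_def neighbours_def by (metis in_set_conv_nth mem_Collect_eq)

lemma link_path_nth_adj: "link_path v xs \<Longrightarrow> i < length xs \<Longrightarrow> v \<rightarrow> xs ! i"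
  unfolding link_path_def neighbours_def using nth_mem by blast

lemma link_path_triangle:
  assumes "link_path v xs" "Suc i < length xs"
  shows "{v, xs ! i, xs ! Suc i} \<in> triangles"
  using assms link_path_nth_adj link_path_adj by (intro trianglesI) auto

text \<open>A path with at least two vertices has no isolated vertex, so the edge lies in a
  triangle.\<close>

lemma common_neighbour:
  assumes "u \<rightarrow> v"
  obtains w where "u \<rightarrow> w" "v \<rightarrow> w"
proof -
  obtain xs where xs: "link_path u xs" using link_path_exists adj_in_verts[OF assms] by blast
  obtain i where i: "i < length xs" "v = xs ! i" using link_path_index[OF xs assms] .
  have "2 \<le> length xs" using xs by (simp add: link_path_def)
  then obtain j where j: "j < length xs" "j = Suc i \<or> i = Suc j"
    using i(1) by (metis Suc_le_eq Suc_lessD not0_implies_Suc numeral_2_eq_2)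
  then show ?thesis using that[of "xs ! j"] link_path_nth_adj[OF xs] link_path_adj[OF xs] i by blast
qed

text \<open>The common neighbours of \<open>u\<close> and \<open>v\<close> are the neighbours of
  \<open>v\<close> on the path formed by the neighbourhood of \<open>u\<close>.\<close>

lemma card_common_neighbours:
  assumes "u \<rightarrow> v"
  shows "card {w. u \<rightarrow> w \<and> v \<rightarrow> w} \<le> 2"
proof -
  obtain xs where xs: "link_path u xs" using link_path_exists adj_in_verts[OF assms] by blast
  obtain i where i: "i < length xs" "v = xs ! i" using link_path_index[OF xs assms] .
  have "{w. u \<rightarrow> w \<and> v \<rightarrow> w} \<subseteq> {xs ! (i - 1), xs ! Suc i}"
    using i link_path_adj[OF xs] by (auto elim!: link_path_index[OF xs])
  then have "card {w. u \<rightarrow> w \<and> v \<rightarrow> w} \<le> card {xs ! (i - 1), xs ! Suc i}"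
    by (intro card_mono) auto
  also have "\<dots> \<le> 2" by (simp add: card_insert_if)
  finally show ?thesis .
qed

text \<open>Triangles at \<open>v\<close> correspond to edges of its neighbourhood path, that is, to
  pairs of consecutive positions.\<close>

lemma triangles_at:
  assumes xs: "link_path v xs"
  shows "{T \<in> triangles. v \<in> T} = (\<lambda>i. {v, xs ! i, xs ! Suc i}) ` {..<length xs - 1}"
proof
  show "{T \<in> triangles. v \<in> T} \<subseteq> (\<lambda>i. {v, xs ! i, xs ! Suc i}) ` {..<length xs - 1}"
  proof
    fix T assume T: "T \<in> {T \<in> triangles. v \<in> T}"
    then have "card (T - {v}) = 2" using card_triangle by (simp add: card_Diff_singleton)
    then obtain a where "a \<in> T - {v}" by (metis card.empty all_not_in_conv zero_neq_numeral)
    then obtain b where b: "T = {v, a, b}" "v \<rightarrow> a" "a \<rightarrow> b" "v \<rightarrow> b"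
      using triangle_completion[of T v a] T by blast
    obtain i where i: "i < length xs" "a = xs ! i" using link_path_index[OF xs b(2)] .
    obtain j where j: "j < length xs" "b = xs ! j" using link_path_index[OF xs b(4)] .
    have "j = Suc i \<or> i = Suc j" using b(3) i j link_path_adj[OF xs] by blast
    then show "T \<in> (\<lambda>i. {v, xs ! i, xs ! Suc i}) ` {..<length xs - 1}"
    proof
      assume "j = Suc i"
      then show ?thesis using b(1) i j by (intro image_eqI[of _ _ i]) auto
    next
      assume "i = Suc j"
      then show ?thesis using b(1) i j by (intro image_eqI[of _ _ j]) auto
    qed
  qed
  show "(\<lambda>i. {v, xs ! i, xs ! Suc i}) ` {..<length xs - 1} \<subseteq> {T \<in> triangles. v \<in> T}"
    using link_path_triangle[OF xs] by auto
qed

lemma card_triangles_at: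
  assumes "v \<in> verts G"
  shows "card (neighbours G v) = Suc (card {T \<in> triangles. v \<in> T})"
proof -
  obtain xs where xs: "link_path v xs" using link_path_exists assms by blast
  have d: "distinct xs" "2 \<le> length xs" "set xs = neighbours G v"
    using xs by (auto simp: link_path_def)
  have vn: "v \<noteq> xs ! i" if "i < length xs" for i
    using link_path_nth_adj[OF xs that] adj_irrefl by metis
  have "inj_on (\<lambda>i. {v, xs ! i, xs ! Suc i}) {..<length xs - 1}"
  proof (rule inj_onI)
    fix i j assume ij: "i \<in> {..<length xs - 1}" "j \<in> {..<length xs - 1}"
      "{v, xs ! i, xs ! Suc i} = {v, xs ! j, xs ! Suc j}"
    then have "{xs ! i, xs ! Suc i} = {xs ! j, xs ! Suc j}"
      using vn[of i] vn[of j] vn[of "Suc i"] vn[of "Suc j"] by (auto simp: insert_eq_iff)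
    then show "i = j" using ij d(1) by (auto simp: doubleton_eq_iff nth_eq_iff_index_eq)
  qed
  then have "card {T \<in> triangles. v \<in> T} = length xs - 1"
    unfolding triangles_at[OF xs] by (simp add: card_image)
  moreover have "card (neighbours G v) = length xs" using d distinct_card by metis
  ultimately show ?thesis using d(2) by simp
qed

section \<open>Double counting of edges and triangles\<close>

lemma finite_edges: "finite (edges G)"
  unfolding edges_def by simp

lemma edges_eq: "edges G = {{u, v} | u v. u \<rightarrow> v}"
  unfolding edges_def arcs_ends_conv by auto

lemma card_edges_at:
  "card {e \<in> edges G. v \<in> e} = card (neighbours G v)"
proof -
  have "{e \<in> edges G. v \<in> e} = (\<lambda>u. {v, u}) ` neighbours G v"
    unfolding edges_eq neighbours_def by (auto simp: insert_commute dest: adj_sym)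
  moreover have "inj_on (\<lambda>u. {v, u}) (neighbours G v)"
    by (rule inj_onI) (auto simp: doubleton_eq_iff)
  ultimately show ?thesis by (simp add: card_image)
qed

text \<open>Degrees are summed over all vertices. Each edge is counted twice; on the other hand,
  each degree is one more than the number of triangles at the vertex, and each triangle is counted
  three times.\<close>

lemma edge_count: "2 * card (edges G) = 3 * card triangles + card (verts G)"
proof -
  have "(\<Sum>v\<in>verts G. card {e \<in> edges G. v \<in> e}) = 2 * card (edges G)"
  proof (rule sum_multicount)
    show "\<forall>e\<in>edges G. card {v \<in> verts G. v \<in> e} = 2"
    proof
      fix e assume "e \<in> edges G"
      then obtain u v where e: "e = {u, v}" "u \<rightarrow> v" unfolding edges_eq by blast
      then have "{v \<in> verts G. v \<in> e} = {u, v}" "u \<noteq> v" using adj_in_verts adj_irrefl by auto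
      then show "card {v \<in> verts G. v \<in> e} = 2" by simp
    qed
  qed (simp_all add: finite_edges)
  moreover have "(\<Sum>v\<in>verts G. card {T \<in> triangles. v \<in> T}) = 3 * card triangles"
  proof (rule sum_multicount)
    show "\<forall>T\<in>triangles. card {v \<in> verts G. v \<in> T} = 3"
    proof
      fix T assume T: "T \<in> triangles"
      then have "{v \<in> verts G. v \<in> T} = T" using triangle_subset_verts by blast
      then show "card {v \<in> verts G. v \<in> T} = 3" using card_triangle[OF T] by simp
    qed
  qed (simp_all add: finite_triangles)
  moreover have "(\<Sum>v\<in>verts G. card {e \<in> edges G. v \<in> e}) =
      (\<Sum>v\<in>verts G. card {T \<in> triangles. v \<in> T} + 1)"
    by (intro sum.cong refl) (simp add: card_edges_at card_triangles_at)
  ultimately show ?thesis unfolding sum.distrib by simp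
qed

section \<open>Connection of triangles through shared edges\<close>

lemma Union_triangles: "\<Union>triangles = verts G"
proof
  show "verts G \<subseteq> \<Union>triangles"
  proof
    fix v assume "v \<in> verts G"
    then obtain xs where xs: "link_path v xs" using link_path_exists by blast
    then have "Suc 0 < length xs" by (auto simp: link_path_def)
    then show "v \<in> \<Union>triangles" using link_path_triangle[OF xs] by blast
  qed
qed (use triangle_subset_verts in blast)

text \<open>Consecutive triangles around \<open>v\<close> share an edge at \<open>v\<close>, so a
  closed family contains all triangles at \<open>v\<close> as soon as it contains one. Since every
  edge lies in a triangle, connectedness carries this to the whole graph. Read contrapositively: for
  a nonempty proper subfamily, some triangle outside shares an edge with one inside.\<close>

lemma edge_closed_triangles:
  assumes sub: "\<T> \<subseteq> triangles" and ne: "\<T> \<noteq> {}"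
    and closed: "\<And>T T' a b. T \<in> \<T> \<Longrightarrow> T' \<in> triangles \<Longrightarrow> a \<noteq> b \<Longrightarrow> a \<in> T \<Longrightarrow> b \<in> T \<Longrightarrow>
      a \<in> T' \<Longrightarrow> b \<in> T' \<Longrightarrow> T' \<in> \<T>"
  shows "\<T> = triangles"
proof -
  have star: "T' \<in> \<T>" if T: "T \<in> \<T>" "v \<in> T" and T': "T' \<in> triangles" "v \<in> T'" for T T' v
  proof -
    have "v \<in> verts G" using T' triangle_subset_verts by blast
    then obtain xs where xs: "link_path v xs" using link_path_exists by blast
    define P where "P i = ({v, xs ! i, xs ! Suc i} \<in> \<T>)" for i
    have step: "P (Suc i) = P i" if i: "Suc (Suc i) < length xs" for i
    proof -
      have tr: "{v, xs ! i, xs ! Suc i} \<in> triangles"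
        "{v, xs ! Suc i, xs ! Suc (Suc i)} \<in> triangles"
        using link_path_triangle[OF xs] i by auto
      have "v \<noteq> xs ! Suc i" using link_path_nth_adj[OF xs, of "Suc i"] i adj_irrefl by auto
      then show ?thesis unfolding P_def
        using closed[OF _ tr(1), of "{v, xs ! Suc i, xs ! Suc (Suc i)}" v "xs ! Suc i"]
          closed[OF _ tr(2), of "{v, xs ! i, xs ! Suc i}" v "xs ! Suc i"] by auto
    qed
    have all: "P i = P 0" if "Suc i < length xs" for i
      using that by (induction i) (auto simp: step)
    have "T \<in> {T \<in> triangles. v \<in> T}" "T' \<in> {T \<in> triangles. v \<in> T}" using T T' sub by auto
    then obtain i j where i: "i < length xs - 1" "T = {v, xs ! i, xs ! Suc i}"
      and j: "j < length xs - 1" "T' = {v, xs ! j, xs ! Suc j}"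
      unfolding triangles_at[OF xs] by blast
    have "P i" using T i by (simp add: P_def)
    then have "P j" using all[of i] all[of j] i j by simp
    then show ?thesis using j by (simp add: P_def)
  qed
  obtain T where T: "T \<in> \<T>" using ne by blast
  then have "card T = 3" using sub card_triangle by blast
  then obtain v where v: "v \<in> T" by fastforce
  have cover: "verts G \<subseteq> \<Union>\<T>"
  proof (rule adj_closed_eq_verts[of v])
    show "v \<in> \<Union>\<T>" using T v by blast
    show "v \<in> verts G" using T v sub triangle_subset_verts by blast
    fix x y assume x: "x \<in> \<Union>\<T>" "x \<rightarrow> y"
    then obtain z where z: "x \<rightarrow> z" "y \<rightarrow> z" using common_neighbour by blast
    then have "{x, y, z} \<in> triangles" using x trianglesI by blast
    then have "{x, y, z} \<in> \<T>" using star x(1) by blast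
    then show "y \<in> \<Union>\<T>" by blast
  qed
  have "triangles \<subseteq> \<T>"
  proof
    fix T' assume T': "T' \<in> triangles"
    obtain x where x: "x \<in> T'" using card_triangle[OF T'] by fastforce
    then obtain S where "S \<in> \<T>" "x \<in> S" using triangle_subset_verts[OF T'] cover by blast
    then show "T' \<in> \<T>" using star T' x by blast
  qed
  then show ?thesis using sub by blast
qed

text \<open>If every triangle of a growing family contributes a new vertex, the family triangulates a disc,
  whose boundary is a closed path through all of its vertices.\<close>

definition triangulated_disc :: "'a set set \<Rightarrow> bool" where
  "triangulated_disc \<T> \<longleftrightarrow> (\<exists>w. closed_vpath G w \<and> set w = \<Union>\<T> \<and>
     (\<forall>a b. a \<noteq> b \<longrightarrow> card {T \<in> \<T>. {a, b} \<subseteq> T} = 1 \<longrightarrow> {a, b} \<in> walk_edges w))"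

lemma triangulated_disc_single:
  assumes "T \<in> triangles"
  shows "triangulated_disc {T}"
proof -
  obtain a b c where T: "T = {a, b, c}" "a \<rightarrow> b" "b \<rightarrow> c" "a \<rightarrow> c"
    using assms unfolding triangles_def by blast
  define w where "w = [a, b, c, a]"
  have "closed_vpath G w"
    using T adj_sym[OF T(4)] adj_irrefl[of a] adj_irrefl[of b] adj_irrefl[of c]
      adj_in_verts[OF T(2)] adj_in_verts[OF T(3)]
    unfolding w_def closed_vpath_def vwalk_def by auto
  moreover have "set w = \<Union>{T}" by (auto simp: w_def T)
  moreover have "{x, y} \<in> walk_edges w" if "x \<noteq> y" "card {T' \<in> {T}. {x, y} \<subseteq> T'} = 1" for x y
  proof -
    have "{x, y} \<subseteq> T"
    proof (rule ccontr)
      assume "\<not> {x, y} \<subseteq> T"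
      then have "{T' \<in> {T}. {x, y} \<subseteq> T'} = {}" by blast
      then show False using that(2) by (metis card.empty zero_neq_one)
    qed
    then show ?thesis using that(1) by (auto simp: T w_def walk_edges_def insert_commute)
  qed
  ultimately show ?thesis unfolding triangulated_disc_def by blast
qed

text \<open>Because \<open>c\<close> is new, the edge \<open>{a, b}\<close> lay in only one triangle
  of the family and thus on the boundary walk. The new triangle makes it an inner edge and adds
  \<open>{a, c}\<close> and \<open>{b, c}\<close> to the boundary, so the walk takes the detour over
  \<open>c\<close>.\<close>

lemma triangulated_disc_insert:
  assumes disc: "triangulated_disc \<T>" and sub: "\<T> \<subseteq> triangles"
    and T: "T \<in> \<T>" "a \<in> T" "b \<in> T" "a \<noteq> b"
    and abc: "{a, b, c} \<in> triangles" "a \<rightarrow> b" "b \<rightarrow> c" "a \<rightarrow> c" and c: "c \<notin> \<Union>\<T>"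
  shows "triangulated_disc (insert {a, b, c} \<T>)"
proof -
  let ?T = "{a, b, c}"
  obtain w where w: "closed_vpath G w" "set w = \<Union>\<T>"
    and we: "\<And>x y. x \<noteq> y \<Longrightarrow> card {T \<in> \<T>. {x, y} \<subseteq> T} = 1 \<Longrightarrow> {x, y} \<in> walk_edges w"
    using disc unfolding triangulated_disc_def by blast
  have fin: "finite \<T>" using sub finite_triangles finite_subset by blast
  have new: "?T \<notin> \<T>" using c by blast
  \<comment> \<open>A second triangle of the family on this edge would yield, together with
    \<open>c\<close>, three common neighbours of \<open>a\<close> and \<open>b\<close>.\<close>
  have "{T \<in> \<T>. {a, b} \<subseteq> T} = {T}"
  proof (rule ccontr)
    assume "{T \<in> \<T>. {a, b} \<subseteq> T} \<noteq> {T}"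
    then obtain T' where T': "T' \<in> \<T>" "a \<in> T'" "b \<in> T'" "T' \<noteq> T" using T by blast
    obtain d where d: "T = {a, b, d}" "b \<rightarrow> d" "a \<rightarrow> d"
      using triangle_completion[of T a b] T sub by blast
    obtain d' where d': "T' = {a, b, d'}" "b \<rightarrow> d'" "a \<rightarrow> d'"
      using triangle_completion[of T' a b] T' T(4) sub by blast
    have "d \<noteq> d'" "c \<noteq> d" "c \<noteq> d'" using T'(1,4) T(1) d(1) d'(1) c by auto
    then have "card {c, d, d'} = 3" by simp
    moreover have "finite {w. a \<rightarrow> w \<and> b \<rightarrow> w}"
      by (rule finite_subset[of _ "verts G"]) (auto dest: adj_in_verts(2))
    then have "card {c, d, d'} \<le> card {w. a \<rightarrow> w \<and> b \<rightarrow> w}"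
      using abc d d' by (intro card_mono) auto
    ultimately show False using card_common_neighbours[OF abc(2)] by simp
  qed
  then have ab: "{a, b} \<in> walk_edges w" using we[OF T(4)] by simp
  have cV: "c \<in> verts G" "c \<notin> set w" using c w(2) adj_in_verts[OF abc(3)] by auto
  \<comment> \<open>The walk may traverse the edge in either direction, and the detour follows that
    direction.\<close>
  have "\<exists>w'. closed_vpath G w' \<and> set w' = insert c (set w) \<and>
      insert {a, c} (insert {b, c} (walk_edges w - {{a, b}})) \<subseteq> walk_edges w'"
  proof (cases "(a, b) \<in> set (vwalk_arcs w)")
    case True
    then show ?thesis using closed_vpath_detour_arc[OF w(1) True cV(2) abc(4) adj_sym[OF abc(3)] cV(1)]
      by simp
  next
    case False
    then have ba: "(b, a) \<in> set (vwalk_arcs w)" using ab by (auto simp: walk_edges_def doubleton_eq_iff)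
    show ?thesis using closed_vpath_detour_arc[OF w(1) ba cV(2) abc(3) adj_sym[OF abc(4)] cV(1)]
      by (simp add: insert_commute)
  qed
  then obtain w' where w': "closed_vpath G w'" "set w' = insert c (set w)"
    "{a, c} \<in> walk_edges w'" "{b, c} \<in> walk_edges w'" "walk_edges w - {{a, b}} \<subseteq> walk_edges w'"
    by blast
  have "{x, y} \<in> walk_edges w'"
    if xy: "x \<noteq> y" "card {T \<in> insert ?T \<T>. {x, y} \<subseteq> T} = 1" for x y
  proof -
    \<comment> \<open>The edge \<open>{a, b}\<close> now lies in both \<open>T\<close> and the new
      triangle, so the new walk need not contain it.\<close>
    have not_ab: "{x, y} \<noteq> {a, b}"
    proof
      assume "{x, y} = {a, b}"
      then have "card {?T, T} \<le> card {T \<in> insert ?T \<T>. {x, y} \<subseteq> T}"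
        using T fin by (intro card_mono) auto
      moreover have "?T \<noteq> T" using new T by blast
      ultimately show False using xy(2) by simp
    qed
    show ?thesis
    proof (cases "{x, y} \<subseteq> ?T")
      case True
      then have "{x, y} = {a, c} \<or> {x, y} = {b, c}" using not_ab xy(1) by auto
      then show ?thesis using w' by auto
    next
      case False
      then have "{T \<in> insert ?T \<T>. {x, y} \<subseteq> T} = {T \<in> \<T>. {x, y} \<subseteq> T}" by blast
      then show ?thesis using we[OF xy(1)] xy(2) not_ab w'(5) by auto
    qed
  qed
  moreover have "set w' = \<Union>(insert ?T \<T>)" using w'(2) w(2) T by auto
  ultimately show ?thesis using w'(1) unfolding triangulated_disc_def by blast
qed

text \<open>One triangle has 1 + 2 vertices, and each further one shares two vertices with an
  earlier one, so it adds at most one. If the bound is attained after a step, it was attained before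
  and the step added a new vertex, so the disc extends.\<close>

lemma grow_triangles:
  assumes "1 \<le> k" "k \<le> card triangles"
  shows "\<exists>\<T> \<subseteq> triangles. card \<T> = k \<and> card (\<Union>\<T>) \<le> k + 2 \<and>
           (card (\<Union>\<T>) = k + 2 \<longrightarrow> triangulated_disc \<T>)"
  using assms
proof (induction k rule: dec_induct)
  case base
  then obtain T where T: "T \<in> triangles" by fastforce
  then show ?case
    using card_triangle[OF T] triangulated_disc_single[OF T] by (intro exI[of _ "{T}"]) auto
next
  case (step k)
  then obtain \<T> where \<T>: "\<T> \<subseteq> triangles" "card \<T> = k" "card (\<Union>\<T>) \<le> k + 2"
    "card (\<Union>\<T>) = k + 2 \<longrightarrow> triangulated_disc \<T>" by auto
  have "\<T> \<noteq> {}" "\<T> \<noteq> triangles" using step \<T>(2) by auto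
  then obtain T T' a b where T: "T \<in> \<T>" "T' \<in> triangles" "a \<noteq> b" "a \<in> T" "b \<in> T"
      "a \<in> T'" "b \<in> T'" "T' \<notin> \<T>"
    using edge_closed_triangles[OF \<T>(1)] by blast
  obtain c where c: "T' = {a, b, c}" "a \<rightarrow> b" "b \<rightarrow> c" "a \<rightarrow> c"
    using triangle_completion[OF T(2,6,7,3)] by blast
  have fin: "finite \<T>" "finite (\<Union>\<T>)"
    using \<T>(1) finite_triangles triangle_subset_verts finite_subset[of \<T> triangles]
      finite_subset[of "\<Union>\<T>" "verts G"] by (blast, auto)
  have U: "\<Union>(insert T' \<T>) = insert c (\<Union>\<T>)" using T c by auto
  have "card (insert T' \<T>) = Suc k" using T(8) \<T>(2) fin by simp
  moreover have "card (\<Union>(insert T' \<T>)) \<le> Suc k + 2"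
    unfolding U using \<T>(3) fin by (simp add: card_insert_if)
  moreover have "triangulated_disc (insert T' \<T>)" if "card (\<Union>(insert T' \<T>)) = Suc k + 2"
  proof -
    have "c \<notin> \<Union>\<T>" "card (\<Union>\<T>) = k + 2"
      using that \<T>(3) fin unfolding U by (auto simp: card_insert_if split: if_splits)
    then show ?thesis
      using triangulated_disc_insert[OF _ \<T>(1) T(1,4,5,3)] \<T>(4) T(2) c by auto
  qed
  ultimately show ?case using \<T>(1) T(2) by (intro exI[of _ "insert T' \<T>"]) auto
qed

lemma hamiltonian_if_few_edges:
  assumes "card (edges G) < 2 * card (verts G)"
  shows "hamiltonian G"
proof -
  have "triangles \<noteq> {}" using Union_triangles card_verts by auto
  then have "1 \<le> card triangles" using finite_triangles by (simp add: Suc_le_eq card_gt_0_iff)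
  then obtain \<T> where \<T>: "\<T> \<subseteq> triangles" "card \<T> = card triangles"
    "card (\<Union>\<T>) \<le> card triangles + 2" "card (\<Union>\<T>) = card triangles + 2 \<longrightarrow> triangulated_disc \<T>"
    using grow_triangles[of "card triangles"] by auto
  have eq: "\<T> = triangles" using card_subset_eq[OF finite_triangles] \<T> by blast
  \<comment> \<open>With n vertices, m edges and t triangles, 2m = 3t + n and m < 2n give t < n.
    Moreover n \<le> t + 2, and t and n have the same parity, which leaves n = t + 2.\<close>
  have "card (verts G) = card triangles + 2"
    using edge_count assms \<T>(3) unfolding eq Union_triangles by presburger
  then have "triangulated_disc triangles" using \<T>(4) unfolding eq Union_triangles by simp
  then obtain w where "closed_vpath G w" "set w = verts G"
    unfolding triangulated_disc_def Union_triangles by blast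
  then show ?thesis using closed_vpath_imp_hamiltonian wf_digraph card_verts by blast
qed

end

lemma nonham_locally_linear_size:
  assumes "nonham_locally_linear G" "3 \<le> card (verts G)"
  shows "2 * card (verts G) \<le> card (edges G)"
proof -
  have "locally_linear_graph G"
    using assms unfolding nonham_locally_linear_def locally_linear_graph_def
      locally_linear_graph_axioms_def by blast
  then show ?thesis
    using assms locally_linear_graph.hamiltonian_if_few_edges
    unfolding nonham_locally_linear_def by (meson not_le)
qed

section \<open>Sparse nonhamiltonian locally linear graphs\<close>

lemma vwalk_arcs_conv_nth: "set (vwalk_arcs xs) = {(xs ! i, xs ! Suc i) | i. Suc i < length xs}"
proof (induction xs rule: vwalk_arcs.induct)
  case (3 x y xs)
  have "{(zs ! i, zs ! Suc i) | i. Suc i < length zs} =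
      insert (x, y) {((y # xs) ! i, (y # xs) ! Suc i) | i. Suc i < length (y # xs)}"
    if "zs = x # y # xs" for zs
  proof (intro equalityI subsetI)
    fix p assume "p \<in> {(zs ! i, zs ! Suc i) | i. Suc i < length zs}"
    then obtain i where "p = (zs ! i, zs ! Suc i)" "Suc i < length zs" by blast
    then show "p \<in> insert (x, y) {((y # xs) ! i, (y # xs) ! Suc i) | i. Suc i < length (y # xs)}"
      using that by (cases i) auto
  next
    fix p assume "p \<in> insert (x, y) {((y # xs) ! i, (y # xs) ! Suc i) | i. Suc i < length (y # xs)}"
    then consider "p = (x, y)"
      | i where "p = ((y # xs) ! i, (y # xs) ! Suc i)" "Suc i < length (y # xs)" by blast
    then show "p \<in> {(zs ! i, zs ! Suc i) | i. Suc i < length zs}"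
    proof cases
      case 1
      then show ?thesis using that by (intro CollectI exI[of _ 0]) auto
    next
      case 2
      then show ?thesis using that by (intro CollectI exI[of _ "Suc i"]) auto
    qed
  qed
  then show ?case using 3 by simp
qed auto

text \<open>The index condition of \<open>path_graph\<close> is traded for membership in
  \<open>vwalk_arcs\<close>, which the simplifier evaluates on explicit lists. That list holds one
  orientation of each edge, hence the disjunction.\<close>

lemma path_graph_induce_subgraphI:
  assumes G: "graph G" and xs: "xs \<noteq> []" "distinct xs" "set xs \<subseteq> verts G"
    and adj: "\<And>u v. u \<in> set xs \<Longrightarrow> v \<in> set xs \<Longrightarrow>
      u \<rightarrow>\<^bsub>G\<^esub> v \<longleftrightarrow> (u, v) \<in> set (vwalk_arcs xs) \<or> (v, u) \<in> set (vwalk_arcs xs)"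
  shows "path_graph (G \<restriction> set xs)"
proof -
  interpret graph G by fact
  have ind: "induced_subgraph (G \<restriction> set xs) G" using xs(3) by (rule induced_induce)
  then have "subgraph (G \<restriction> set xs) G" by (rule induced_imp_subgraph)
  then have "digraph (G \<restriction> set xs)" by (rule digraph_subgraph)
  moreover have "symmetric (G \<restriction> set xs)"
    using ind sym_arcs by (rule induced_graph_imp_symmetric[rotated])
  ultimately have "graph (G \<restriction> set xs)"
    by (simp add: graph.intro pseudo_graph.intro sym_digraph.intro sym_digraph_axioms.intro
        digraph.axioms(1) fin_digraph.axioms(1))
  moreover have "arcs_ends (G \<restriction> set xs) =
      {(xs ! i, xs ! j) | i j. i < length xs \<and> j < length xs \<and> (j = Suc i \<or> i = Suc j)}"
    (is "_ = ?P")
  proof (intro set_eqI)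
    fix p :: "'a \<times> 'a"
    obtain u v where p: "p = (u, v)" by force
    have "set (vwalk_arcs xs) \<subseteq> set xs \<times> set xs"
      unfolding vwalk_arcs_conv_nth by auto
    then have "p \<in> arcs_ends (G \<restriction> set xs) \<longleftrightarrow>
        (u, v) \<in> set (vwalk_arcs xs) \<or> (v, u) \<in> set (vwalk_arcs xs)"
      unfolding p dominates_induce_subgraph_iff using adj by blast
    also have "\<dots> \<longleftrightarrow> p \<in> ?P"
      unfolding vwalk_arcs_conv_nth p by (auto dest: Suc_lessD)
    finally show "p \<in> arcs_ends (G \<restriction> set xs) \<longleftrightarrow> p \<in> ?P" .
  qed
  ultimately show ?thesis unfolding path_graph_def using xs by auto
qed

text \<open>The vertices 0, 1, 9, 2, 10, 3, 11, 4, in this cyclic order, form the square of an 8-cycle, which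
  triangulates an annulus. The ears 5, 6, 7, 8 sit on the boundary component 1, 2, 3, 4 and make the
  graph nonhamiltonian; the fan 12, 13, \<dots> with centre 0 is attached to the edge 0, 11 of the other
  boundary component.\<close>

definition core_edges :: "(nat \<times> nat) list" where
  "core_edges =
    [(0, 1), (1, 9), (2, 9), (2, 10), (3, 10), (3, 11), (4, 11), (0, 4),
     (0, 9), (1, 2), (9, 10), (2, 3), (10, 11), (3, 4), (0, 11), (1, 4),
     (1, 5), (2, 5), (2, 6), (3, 6), (3, 7), (4, 7), (1, 8), (4, 8)]"

text \<open>For \<open>k = 12\<close> the two new pairs are (0, 12) and (11, 12), so the fan starts
  with the triangle 0, 11, 12. Each fan vertex adds two edges to the 24 edges on the 12 core
  vertices.\<close>

definition fan_edges :: "nat \<Rightarrow> (nat \<times> nat) set" where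
  "fan_edges n = set core_edges \<union> Pair 0 ` {12..<n} \<union> (\<lambda>k. (k - 1, k)) ` {12..<n}"

definition fan_graph :: "nat \<Rightarrow> (nat, nat \<times> nat) pre_digraph" where
  "fan_graph n = \<lparr>verts = {..<n}, arcs = fan_edges n \<union> (fan_edges n)\<inverse>, tail = fst, head = snd\<rparr>"

lemma fan_edges_iff:
  "(u, v) \<in> fan_edges n \<longleftrightarrow> (u, v) \<in> set core_edges \<or> 12 \<le> v \<and> v < n \<and> (u = 0 \<or> Suc u = v)"
  unfolding fan_edges_def by (auto simp: image_iff)

text \<open>Listing the smaller end first excludes loops and lets each undirected edge occur only
  once, which is what the edge count rests on.\<close>

lemma fan_edges_less: "(u, v) \<in> fan_edges n \<Longrightarrow> u < v"
  unfolding fan_edges_iff core_edges_def by auto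

lemma fan_graph_simps:
  "verts (fan_graph n) = {..<n}" "tail (fan_graph n) = fst" "head (fan_graph n) = snd"
  "arcs (fan_graph n) = fan_edges n \<union> (fan_edges n)\<inverse>"
  by (simp_all add: fan_graph_def)

lemma fan_graph_adj: "u \<rightarrow>\<^bsub>fan_graph n\<^esub> v \<longleftrightarrow> (u, v) \<in> fan_edges n \<or> (v, u) \<in> fan_edges n"
  by (auto simp: arcs_ends_conv fan_graph_simps)

lemma graph_fan_graph:
  assumes "12 \<le> n"
  shows "graph (fan_graph n)"
proof
  have "(u, v) \<in> fan_edges n \<Longrightarrow> u < n \<and> v < n" for u v
    using assms unfolding fan_edges_iff core_edges_def by auto
  then show "\<And>e. e \<in> arcs (fan_graph n) \<Longrightarrow> tail (fan_graph n) e \<in> verts (fan_graph n)"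
    "\<And>e. e \<in> arcs (fan_graph n) \<Longrightarrow> head (fan_graph n) e \<in> verts (fan_graph n)"
    by (auto simp: fan_graph_simps)
  show "symmetric (fan_graph n)"
    unfolding symmetric_def by (auto simp: sym_def fan_graph_adj)
  show "finite (arcs (fan_graph n))" by (auto simp: fan_graph_simps fan_edges_def)
qed (auto simp: fan_graph_simps arc_to_ends_def dest: fan_edges_less)

lemma connected_fan_graph:
  assumes n: "12 \<le> n"
  shows "Digraph_Component.connected (fan_graph n)"
proof -
  interpret graph "fan_graph n" using n by (rule graph_fan_graph)
  have edge: "u \<rightarrow>\<^sup>*\<^bsub>fan_graph n\<^esub> v" if "(u, v) \<in> fan_edges n \<or> (v, u) \<in> fan_edges n" for u v
    using that unfolding fan_graph_adj[symmetric] by blast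
  have zero: "0 \<rightarrow>\<^sup>*\<^bsub>fan_graph n\<^esub> v" if "v < n" for v
  proof -
    have nbs: "0 \<rightarrow>\<^sup>*\<^bsub>fan_graph n\<^esub> v" if "v \<in> {1, 4, 9, 11} \<or> 12 \<le> v \<and> v < n" for v
      using that by (intro edge) (auto simp: fan_edges_iff core_edges_def)
    \<comment> \<open>The core vertices not adjacent to 0 are reached over 1, over 4, or over 3,
      which itself is reached over 4.\<close>
    have "1 \<rightarrow>\<^sup>*\<^bsub>fan_graph n\<^esub> v" if "v \<in> {2, 5, 8}" for v
      using that by (intro edge) (auto simp: fan_edges_iff core_edges_def)
    moreover have "4 \<rightarrow>\<^sup>*\<^bsub>fan_graph n\<^esub> v" if "v \<in> {3, 7}" for v
      using that by (intro edge) (auto simp: fan_edges_iff core_edges_def)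
    moreover have "3 \<rightarrow>\<^sup>*\<^bsub>fan_graph n\<^esub> v" if "v \<in> {6, 10}" for v
      using that by (intro edge) (auto simp: fan_edges_iff core_edges_def)
    moreover have "v = 0 \<or> v \<in> {1, 4, 9, 11} \<or> v \<in> {2, 5, 8} \<or> v \<in> {3, 7} \<or> v \<in> {6, 10} \<or> 12 \<le> v"
      unfolding insert_iff empty_iff by presburger
    ultimately show ?thesis
      using nbs that n reachable_trans reachable_refl[of 0]
      by (smt (verit) fan_graph_simps(1) insertCI lessThan_iff)
  qed
  show ?thesis
  proof (rule connectedI)
    fix u v assume "u \<in> verts (fan_graph n)" "v \<in> verts (fan_graph n)"
    then have "0 \<rightarrow>\<^sup>*\<^bsub>fan_graph n\<^esub> u" "0 \<rightarrow>\<^sup>*\<^bsub>fan_graph n\<^esub> v" using zero by (auto simp: fan_graph_simps)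
    then have "u \<rightarrow>\<^sup>*\<^bsub>fan_graph n\<^esub> v"
      using symmetric_reachable[OF sym_arcs] reachable_trans by blast
    then show "u \<rightarrow>\<^sup>*\<^bsub>with_proj (mk_symmetric (fan_graph n))\<^esub> v" by (rule reachable_mk_symmetricI)
  qed (use n in \<open>auto simp: fan_graph_simps lessThan_empty_iff\<close>)
qed

text \<open>Lists the neighbours of \<open>v\<close> in path order. Only 0, 11 and the fan vertices
  have neighbourhoods that depend on \<open>n\<close>; the table covers the vertices 1 to 10, hence
  the index \<open>v - 1\<close>.\<close>

definition fan_link :: "nat \<Rightarrow> nat \<Rightarrow> nat list" where
  "fan_link n v =
    (if v = 0 then rev [12..<n] @ [11, 4, 1, 9]
     else if v = 11 then [10, 3, 4, 0] @ (if 12 < n then [12] else [])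
     else if 12 \<le> v then [v - 1, 0] @ (if Suc v < n then [Suc v] else [])
     else [[8, 4, 0, 9, 2, 5], [5, 1, 9, 10, 3, 6], [6, 2, 10, 11, 4, 7], [7, 3, 11, 0, 1, 8],
       [1, 2], [2, 3], [3, 4], [4, 1], [0, 1, 2, 10], [9, 2, 3, 11]] ! (v - 1))"

text \<open>The centre is the only vertex whose list has unbounded length, so its consecutive pairs
  need an induction, in which each new fan vertex is put in front.\<close>

lemma vwalk_arcs_fan_link_zero:
  "12 \<le> n \<Longrightarrow> set (vwalk_arcs (rev [12..<n] @ [11, 4, 1, 9])) =
     {(u, w). u = Suc w \<and> 11 \<le> w \<and> u < n} \<union> {(11, 4), (4, 1), (1, 9)}"
proof (induction n rule: dec_induct)
  case base
  then show ?case by auto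
next
  case (step n)
  \<comment> \<open>For an empty fan the first entry is the core vertex 11, which is again
    \<open>n - 1\<close>.\<close>
  have "hd (rev [12..<n] @ [11, 4, 1, 9]) = n - 1"
    using step(1) by (cases "n = 12") (simp_all add: hd_append hd_rev)
  then have "vwalk_arcs (rev [12..<Suc n] @ [11, 4, 1, 9]) =
      (n, n - 1) # vwalk_arcs (rev [12..<n] @ [11, 4, 1, 9])"
    using step(1) by simp
  moreover have "{(u, w). u = Suc w \<and> 11 \<le> w \<and> u < Suc n} =
      insert (n, n - 1) {(u, w). u = Suc w \<and> 11 \<le> w \<and> u < n}"
    using step(1) by auto
  ultimately show ?case using step.IH by (simp only: list.set(2) Un_insert_left)
qed

lemma fan_link:
  assumes n: "12 \<le> n" and v: "v < n"
  shows "neighbours (fan_graph n) v = set (fan_link n v) \<and> distinct (fan_link n v) \<and>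
    (\<forall>u\<in>set (fan_link n v). \<forall>w\<in>set (fan_link n v). u \<rightarrow>\<^bsub>fan_graph n\<^esub> w \<longleftrightarrow>
      (u, w) \<in> set (vwalk_arcs (fan_link n v)) \<or> (w, u) \<in> set (vwalk_arcs (fan_link n v)))"
    (is "?N v \<and> ?D v \<and> ?A v")
proof -
  have "v = 0 \<or> v = 11 \<or> 12 \<le> v \<or> v \<in> {1, 2, 3, 4, 5, 6, 7, 8, 9, 10}"
    unfolding insert_iff empty_iff by presburger
  then consider "v = 0" | "v = 11" | "12 \<le> v" | "v \<in> {1, 2, 3, 4, 5, 6, 7, 8, 9, 10}" by blast
  then show ?thesis
  proof cases
    case 1
    have link: "fan_link n 0 = rev [12..<n] @ [11, 4, 1, 9]" by (simp add: fan_link_def)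
    have "?A 0"
      unfolding link vwalk_arcs_fan_link_zero[OF n] fan_graph_adj fan_edges_iff core_edges_def by auto
    moreover have "?N 0"
      unfolding link neighbours_def fan_graph_adj fan_edges_iff core_edges_def by auto
    moreover have "?D 0" unfolding link by simp
    ultimately show ?thesis using 1 by blast
  next
    case 2
    show ?thesis unfolding 2 neighbours_def fan_graph_adj fan_edges_iff core_edges_def fan_link_def
      by (cases "12 < n") auto
  next
    case 3
    then show ?thesis using v
      unfolding neighbours_def fan_graph_adj fan_edges_iff core_edges_def fan_link_def
      by (cases "Suc v < n") auto
  next
    case 4
    have "?D v \<and> ?A v" using 4
      by (elim insertE emptyE) (simp_all add: fan_link_def fan_graph_adj fan_edges_iff core_edges_def)
    moreover have "?N v" using 4
      by (elim insertE emptyE)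
        (auto simp: neighbours_def fan_link_def fan_graph_adj fan_edges_iff core_edges_def)
    ultimately show ?thesis by blast
  qed
qed

lemma locally_linear_fan_graph:
  assumes n: "12 \<le> n"
  shows "locally_linear (fan_graph n)"
  unfolding locally_linear_def
proof
  interpret graph "fan_graph n" using n by (rule graph_fan_graph)
  fix v assume "v \<in> verts (fan_graph n)"
  then have link: "neighbours (fan_graph n) v = set (fan_link n v)" "distinct (fan_link n v)"
    "\<And>u w. u \<in> set (fan_link n v) \<Longrightarrow> w \<in> set (fan_link n v) \<Longrightarrow> u \<rightarrow>\<^bsub>fan_graph n\<^esub> w \<longleftrightarrow>
      (u, w) \<in> set (vwalk_arcs (fan_link n v)) \<or> (w, u) \<in> set (vwalk_arcs (fan_link n v))"
    using fan_link[OF n, of v] by (simp_all add: fan_graph_simps)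
  have "set (fan_link n v) \<subseteq> verts (fan_graph n)"
    unfolding link(1)[symmetric] neighbours_def using adj_in_verts(2) by blast
  moreover have "fan_link n v \<noteq> []"
    by (auto simp: fan_link_def nth_Cons split: nat.splits)
  ultimately show "path_graph (fan_graph n \<restriction> neighbours (fan_graph n) v)"
    unfolding link(1) using path_graph_induce_subgraphI[OF graph_fan_graph[OF n] _ link(2)] link(3)
    by blast
qed

lemma nonham_locally_linear_fan_graph:
  assumes n: "12 \<le> n"
  shows "nonham_locally_linear (fan_graph n)"
proof -
  have "\<not> hamiltonian (fan_graph n)"
  \<comment> \<open>A cycle would be confined to the four ears and their four neighbours; vertex 0
    witnesses that something is missed.\<close>
  proof (rule not_hamiltonian_if_few_neighbours[of _ "{1, 2, 3, 4}" "{5, 6, 7, 8}" 0])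
    fix q u assume "q \<in> {5, 6, 7, 8}" "q \<rightarrow>\<^bsub>fan_graph n\<^esub> u"
    then show "u \<in> {1, 2, 3, 4}" unfolding fan_graph_adj fan_edges_iff core_edges_def by auto
  qed (use n graph_fan_graph in \<open>auto simp: fan_graph_simps\<close>)
  then show ?thesis unfolding nonham_locally_linear_def
    using n graph_fan_graph connected_fan_graph locally_linear_fan_graph by blast
qed

lemma card_edges_fan_graph:
  assumes "12 \<le> n"
  shows "card (edges (fan_graph n)) = 2 * n"
proof -
  have "edges (fan_graph n) = (\<lambda>(u, v). {u, v}) ` fan_edges n"
  proof -
    have "(\<lambda>e. {fst e, snd e}) ` (fan_edges n)\<inverse> = (\<lambda>e. {fst e, snd e}) ` fan_edges n"
      unfolding converse_unfold by (force simp: image_iff insert_commute)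
    then show ?thesis unfolding edges_def fan_graph_simps image_Un by (simp add: case_prod_unfold)
  qed
  moreover have "inj_on (\<lambda>(u, v). {u, v}) (fan_edges n)"
    by (auto simp: inj_on_def doubleton_eq_iff) (meson fan_edges_less less_asym)+
  moreover have "card (fan_edges n) = 2 * n"
  proof -
    \<comment> \<open>The two families are disjoint because \<open>k - 1\<close> is at least 11,
      never 0.\<close>
    have "card (Pair 0 ` {12..<n} \<union> (\<lambda>k. (k - 1, k)) ` {12..<n}) = 2 * (n - 12)"
      by (subst card_Un_disjoint) (auto simp: card_image inj_on_def)
    moreover have "card (set core_edges) = 24"
      unfolding core_edges_def by simp
    moreover have "set core_edges \<inter> (Pair 0 ` {12..<n} \<union> (\<lambda>k. (k - 1, k)) ` {12..<n}) = {}"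
      unfolding core_edges_def by auto
    ultimately show ?thesis
      unfolding fan_edges_def Un_assoc using assms by (subst card_Un_disjoint) auto
  qed
  ultimately show ?thesis by (simp add: card_image)
qed


theorem theorem2:
  shows "(\<forall>G :: ('a, 'b) pre_digraph.
            nonham_locally_linear G \<and> 3 \<le> card (verts G) \<longrightarrow> 2 * card (verts G) \<le> card (edges G)) \<and>
         (\<forall>n \<ge> 12. \<exists>G :: (nat, nat \<times> nat) pre_digraph.
            nonham_locally_linear G \<and> card (verts G) = n \<and> card (edges G) = 2 * n) \<and>
         (\<forall>n \<ge> 12. (LEAST m. \<exists>G :: (nat, nat \<times> nat) pre_digraph.
            nonham_locally_linear G \<and> card (verts G) = n \<and> card (edges G) = m) = 2 * n)"
proof (intro conjI allI impI)
  fix G :: "('a, 'b) pre_digraph"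
  assume "nonham_locally_linear G \<and> 3 \<le> card (verts G)"
  then show "2 * card (verts G) \<le> card (edges G)" using nonham_locally_linear_size by blast
next
  fix n :: nat assume n: "12 \<le> n"
  have "nonham_locally_linear (fan_graph n) \<and> card (verts (fan_graph n)) = n \<and>
      card (edges (fan_graph n)) = 2 * n"
    using n by (simp add: nonham_locally_linear_fan_graph card_edges_fan_graph fan_graph_simps)
  then show ex: "\<exists>G :: (nat, nat \<times> nat) pre_digraph.
      nonham_locally_linear G \<and> card (verts G) = n \<and> card (edges G) = 2 * n" by blast
  show "(LEAST m. \<exists>G :: (nat, nat \<times> nat) pre_digraph.
      nonham_locally_linear G \<and> card (verts G) = n \<and> card (edges G) = m) = 2 * n"
  proof (rule Least_equality, rule ex)
    fix m
    assume "\<exists>G :: (nat, nat \<times> nat) pre_digraph.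
      nonham_locally_linear G \<and> card (verts G) = n \<and> card (edges G) = m"
    then show "2 * n \<le> m" using nonham_locally_linear_size n by force
  qed
qed

end
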